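(* Let $\{i,j\}=\{1,2\}$ and let $(L,L_1,L_2)$ be a bilocale. If there is an $i$-prefit compactification $h:(M,M_1,M_2)\to(L,L_1,L_2)$ such that $h_*[L]$ is $i$-$G_\delta$-dense in $M$, then $(L,L_1,L_2)$ is $(i,j)$-Baire.
   Context: A locale is a complete lattice $L$ with $a\wedge\bigvee B=\bigvee\{a\wedge b:b\in B\}$ for all $a\in L$, $B\subseteq L$; $\to$ is its Heyting operation. A subframe of $L$ is a subset closed under all joins and finite meets. A bilocale is a triple $(L,L_1,L_2)$ with $L_1,L_2$ subframes of a locale $L$ such that $a=\bigvee\{a_1\wedge a_2:a_1\in L_1,a_2\in L_2,a_1\wedge a_2\le a\}$ for all $a\in L$. It is compact if the top element of $L$ is a compact element. It is regular if for $k=1,2$ and every $x\in L_k$, $x=\bigvee\{a\in L_k:a\prec_k x\}$, where $a\prec_k x$ means that there is $c\in L_l$ ($l\ne k$, $l\in\{1,2\}$) with $a\wedge c=0$ and $c\vee x=1$. For $c\in L_i$ put $c^{\bullet}=\bigvee\{x\in L_j:x\wedge c=0\}$. A bilocale is $i$-prefit if for every nonzero $x\in L$ there is a nonzero $y\in L_i$ with $y^{\bullet}\vee x=1$. A biframe map $h:(M,M_1,M_2)\to(L,L_1,L_2)$ is a frame homomorphism $h:M\to L$ (preserving all joins and finite meets) with $h[M_k]\subseteq L_k$ for $k=1,2$; it is dense if $h(x)=0$ implies $x=0$, and onto if $h[M_k]=L_k$ for $k=1,2$. Its right adjoint is $h_*:L\to M$. A compactification of $(L,L_1,L_2)$ is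 a dense onto biframe map $h:(M,M_1,M_2)\to(L,L_1,L_2)$ with $(M,M_1,M_2)$ compact regular; it is an $i$-prefit compactification if $(M,M_1,M_2)$ is $i$-prefit. A sublocale of $L$ is a subset $S$ closed under all meets with $x\to s\in S$ for all $x\in L$, $s\in S$; the void sublocale is $\mathsf O=\{1\}$. For $a\in L$, $\mathfrak o(a)=\{a\to x:x\in L\}$ is an open sublocale and $\mathfrak c(a)=\{x\in L:a\le x\}$ a closed sublocale. An $i$-$G_\delta$-sublocale is one of the form $\bigcap_{n\in\mathbb N}\mathfrak o(x_n)$ with all $x_n$ in the $i$-th part; a sublocale is $i$-$G_\delta$-dense if it has non-void intersection with every non-void $i$-$G_\delta$-sublocale. A sublocale is $j$-open if it equals $\mathfrak o(a)$ for some $a\in L_j$; $S$ is $i$-dense if $\bigcap\{\mathfrak c(a):a\in L_i,\ S\subseteq\mathfrak c(a)\}=L$. A bilocale is $(i,j)$-Baire if the intersection of any countably many $i$-dense $j$-open sublocales is $i$-dense. *)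

theory Defs
  imports Main "HOL-Library.Countable_Set"
begin

text \<open>
  Locales (frames) are types of the class \<open>frame\<close>.  Top and bottom may coincide.
\<close>

class frame = complete_lattice +
  assumes inf_Sup_frame: "inf a (Sup B) = Sup {inf a b | b. b \<in> B}"

definition heyting :: "'a::frame \<Rightarrow> 'a \<Rightarrow> 'a" where
  "heyting a b = Sup {x. inf a x \<le> b}"

lemma heyting_adjoint: "x \<le> heyting a b \<longleftrightarrow> inf a x \<le> b"
proof
  assume "x \<le> heyting a b"
  then have "inf a x \<le> inf a (heyting a b)"
    by (simp add: le_infI2)
  also have "\<dots> \<le> b"
    unfolding heyting_def inf_Sup_frame by (rule Sup_least) auto
  finally show "inf a x \<le> b" .
qed (auto simp: heyting_def intro: Sup_upper)

definition subframe :: "'a::frame set \<Rightarrow> bool" where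
  "subframe S \<longleftrightarrow>
     (\<forall>A. A \<subseteq> S \<longrightarrow> Sup A \<in> S) \<and> (\<forall>F. finite F \<longrightarrow> F \<subseteq> S \<longrightarrow> Inf F \<in> S)"

text \<open>
  A bilocale is represented by the family \<open>L\<close> of its parts \<open>L 1\<close> and \<open>L 2\<close>; the total part is
  the whole type, and the values of \<open>L\<close> at other indices play no role.
\<close>

definition bilocale :: "(nat \<Rightarrow> 'a::frame set) \<Rightarrow> bool" where
  "bilocale L \<longleftrightarrow> subframe (L 1) \<and> subframe (L 2) \<and>
     (\<forall>a. a = Sup {inf a1 a2 | a1 a2. a1 \<in> L 1 \<and> a2 \<in> L 2 \<and> inf a1 a2 \<le> a})"

definition compact_element :: "'a::complete_lattice \<Rightarrow> bool" where
  "compact_element a \<longleftrightarrow> (\<forall>A. a \<le> Sup A \<longrightarrow> (\<exists>F. finite F \<and> F \<subseteq> A \<and> a \<le> Sup F))"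

definition compact_bilocale :: "(nat \<Rightarrow> 'a::frame set) \<Rightarrow> bool" where
  "compact_bilocale L \<longleftrightarrow> bilocale L \<and> compact_element (top :: 'a)"

text \<open>
  In the relations and predicates below that take two indices, the first is the index named in
  the notation (\<open>a \<prec>\<^sub>k x\<close>, \<open>i\<close>-prefit) and the second is the other one.
\<close>

definition rather_below :: "(nat \<Rightarrow> 'a::frame set) \<Rightarrow> nat \<Rightarrow> nat \<Rightarrow> 'a \<Rightarrow> 'a \<Rightarrow> bool" where
  "rather_below L k l a x \<longleftrightarrow> (\<exists>c \<in> L l. inf a c = bot \<and> sup c x = top)"

definition regular_bilocale :: "(nat \<Rightarrow> 'a::frame set) \<Rightarrow> bool" where
  "regular_bilocale L \<longleftrightarrow> bilocale L \<and>
     (\<forall>k l. {k, l} = {1, 2} \<longrightarrow> (\<forall>x \<in> L k. x = Sup {a \<in> L k. rather_below L k l a x}))"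

text \<open>For \<open>c\<close> in the part other than \<open>L j\<close>, this is \<open>c\<^sup>\<bullet>\<close>.\<close>

definition bullet :: "(nat \<Rightarrow> 'a::frame set) \<Rightarrow> nat \<Rightarrow> 'a \<Rightarrow> 'a" where
  "bullet L j c = Sup {x \<in> L j. inf x c = bot}"

definition prefit :: "(nat \<Rightarrow> 'a::frame set) \<Rightarrow> nat \<Rightarrow> nat \<Rightarrow> bool" where
  "prefit L i j \<longleftrightarrow> (\<forall>x. x \<noteq> bot \<longrightarrow> (\<exists>y \<in> L i. y \<noteq> bot \<and> sup (bullet L j y) x = top))"

definition frame_hom :: "('m::frame \<Rightarrow> 'l::frame) \<Rightarrow> bool" where
  "frame_hom h \<longleftrightarrow>
     (\<forall>A. h (Sup A) = Sup (h ` A)) \<and> (\<forall>F. finite F \<longrightarrow> h (Inf F) = Inf (h ` F))"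

definition right_adjoint :: "('m::frame \<Rightarrow> 'l::frame) \<Rightarrow> 'l \<Rightarrow> 'm" where
  "right_adjoint h y = Sup {x. h x \<le> y}"

lemma right_adjoint_iff:
  assumes "frame_hom h"
  shows "h x \<le> y \<longleftrightarrow> x \<le> right_adjoint h y"
proof
  assume "h x \<le> y"
  then show "x \<le> right_adjoint h y"
    by (auto simp: right_adjoint_def intro: Sup_upper)
next
  have Sup: "h (Sup A) = Sup (h ` A)" for A
    using assms by (simp add: frame_hom_def)
  assume "x \<le> right_adjoint h y"
  then have "right_adjoint h y = Sup {x, right_adjoint h y}"
    by (simp add: sup_absorb2)
  then have "h (right_adjoint h y) = sup (h x) (h (right_adjoint h y))"
    using Sup[of "{x, right_adjoint h y}"] by simp
  then have "h x \<le> h (right_adjoint h y)"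
    by (metis sup_ge1)
  also have "\<dots> \<le> y"
    unfolding right_adjoint_def Sup by (rule Sup_least) auto
  finally show "h x \<le> y" .
qed

definition biframe_map ::
  "(nat \<Rightarrow> 'm::frame set) \<Rightarrow> (nat \<Rightarrow> 'l::frame set) \<Rightarrow> ('m \<Rightarrow> 'l) \<Rightarrow> bool" where
  "biframe_map M L h \<longleftrightarrow>
     bilocale M \<and> bilocale L \<and> frame_hom h \<and> (\<forall>k \<in> {1, 2}. h ` M k \<subseteq> L k)"

definition dense_map :: "('m::frame \<Rightarrow> 'l::frame) \<Rightarrow> bool" where
  "dense_map h \<longleftrightarrow> (\<forall>x. h x = bot \<longrightarrow> x = bot)"

definition onto_map ::
  "(nat \<Rightarrow> 'm::frame set) \<Rightarrow> (nat \<Rightarrow> 'l::frame set) \<Rightarrow> ('m \<Rightarrow> 'l) \<Rightarrow> bool" where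
  "onto_map M L h \<longleftrightarrow> (\<forall>k \<in> {1, 2}. h ` M k = L k)"

definition compactification ::
  "(nat \<Rightarrow> 'm::frame set) \<Rightarrow> (nat \<Rightarrow> 'l::frame set) \<Rightarrow> ('m \<Rightarrow> 'l) \<Rightarrow> bool" where
  "compactification M L h \<longleftrightarrow>
     biframe_map M L h \<and> dense_map h \<and> onto_map M L h \<and> compact_bilocale M \<and> regular_bilocale M"

definition prefit_compactification ::
  "nat \<Rightarrow> nat \<Rightarrow> (nat \<Rightarrow> 'm::frame set) \<Rightarrow> (nat \<Rightarrow> 'l::frame set) \<Rightarrow> ('m \<Rightarrow> 'l) \<Rightarrow> bool" where
  "prefit_compactification i j M L h \<longleftrightarrow> compactification M L h \<and> prefit M i j"

definition sublocale_set :: "'a::frame set \<Rightarrow> bool" where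
  "sublocale_set S \<longleftrightarrow>
     (\<forall>A. A \<subseteq> S \<longrightarrow> Inf A \<in> S) \<and> (\<forall>x. \<forall>s \<in> S. heyting x s \<in> S)"

definition void_sublocale :: "'a::frame set" where
  "void_sublocale = {top}"

definition open_sublocale :: "'a::frame \<Rightarrow> 'a set" where
  "open_sublocale a = {heyting a x | x. True}"

definition closed_sublocale :: "'a::frame \<Rightarrow> 'a set" where
  "closed_sublocale a = {x. a \<le> x}"

definition Gdelta_sublocale :: "(nat \<Rightarrow> 'a::frame set) \<Rightarrow> nat \<Rightarrow> 'a set \<Rightarrow> bool" where
  "Gdelta_sublocale L i G \<longleftrightarrow>
     (\<exists>x :: nat \<Rightarrow> 'a. (\<forall>n. x n \<in> L i) \<and> G = (\<Inter>n. open_sublocale (x n)))"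

definition Gdelta_dense :: "(nat \<Rightarrow> 'a::frame set) \<Rightarrow> nat \<Rightarrow> 'a set \<Rightarrow> bool" where
  "Gdelta_dense L i S \<longleftrightarrow> sublocale_set S \<and>
     (\<forall>G. Gdelta_sublocale L i G \<longrightarrow> G \<noteq> void_sublocale \<longrightarrow> S \<inter> G \<noteq> void_sublocale)"

definition part_open :: "(nat \<Rightarrow> 'a::frame set) \<Rightarrow> nat \<Rightarrow> 'a set \<Rightarrow> bool" where
  "part_open L j U \<longleftrightarrow> (\<exists>a \<in> L j. U = open_sublocale a)"

definition part_dense :: "(nat \<Rightarrow> 'a::frame set) \<Rightarrow> nat \<Rightarrow> 'a set \<Rightarrow> bool" where
  "part_dense L i S \<longleftrightarrow> sublocale_set S \<and>
     \<Inter>{closed_sublocale a | a. a \<in> L i \<and> S \<subseteq> closed_sublocale a} = UNIV"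

definition Baire_bilocale :: "(nat \<Rightarrow> 'a::frame set) \<Rightarrow> nat \<Rightarrow> nat \<Rightarrow> bool" where
  "Baire_bilocale L i j \<longleftrightarrow>
     (\<forall>\<U>. countable \<U> \<longrightarrow> (\<forall>U \<in> \<U>. part_dense L i U \<and> part_open L j U) \<longrightarrow> part_dense L i (\<Inter>\<U>))"

end

(* A nonzero c in L i is the image of some c' in M i. Prefitness yields a decreasing
   sequence of nonzero elements y n of M i below c', with y n below a lift of the n-th dense open
   part and sup (bullet (y (n+1))) (y n) = top. By compactness the join of the bullets is not top;
   it lies in every open sublocale of y n, so the G-delta sublocale that they cut out is not void.
   It therefore meets the image of L in an element other than top, whose preimage in L lies in all
   the open parts but not in the closed sublocale of c. *)
theory Submission
  imports Defs
begin

lemma inf_sup_frame: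
  fixes a x y :: "'a::frame"
  shows "inf a (sup x y) = sup (inf a x) (inf a y)"
proof -
  have "{inf a b |b. b \<in> {x, y}} = {inf a x, inf a y}" by auto
  then show ?thesis using inf_Sup_frame[of a "{x, y}"] by simp
qed

text \<open>The map \<open>heyting a\<close> is idempotent, so its range is the set of its fixed
  points; unfolding the adjunction turns the fixed point condition into a test by inequalities
  alone, the form used from here on.\<close>

lemma mem_open_sublocale_iff:
  "z \<in> open_sublocale a \<longleftrightarrow> (\<forall>x. inf a x \<le> z \<longrightarrow> x \<le> z)"
proof
  assume "z \<in> open_sublocale a"
  then obtain w where w: "z = heyting a w" by (auto simp: open_sublocale_def)
  show "\<forall>x. inf a x \<le> z \<longrightarrow> x \<le> z"
    unfolding w heyting_adjoint by (simp flip: inf.assoc)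
next
  assume *: "\<forall>x. inf a x \<le> z \<longrightarrow> x \<le> z"
  have "heyting a z = z"
    by (rule antisym) (use * heyting_adjoint[of _ a z] in auto)
  then show "z \<in> open_sublocale a" unfolding open_sublocale_def by (metis (mono_tags) CollectI)
qed

lemma top_mem_open_sublocale: "top \<in> open_sublocale a"
  by (simp add: mem_open_sublocale_iff)

lemma sublocale_set_Inter:
  assumes "\<And>S. S \<in> \<S> \<Longrightarrow> sublocale_set S"
  shows "sublocale_set (\<Inter>\<S>)"
  unfolding sublocale_set_def
proof (intro conjI allI impI ballI InterI)
  fix A T assume "A \<subseteq> \<Inter>\<S>" "T \<in> \<S>"
  then have "A \<subseteq> T" by blast
  then show "Inf A \<in> T"
    using assms[OF \<open>T \<in> \<S>\<close>] by (simp add: sublocale_set_def)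
next
  fix x s T assume "s \<in> \<Inter>\<S>" "T \<in> \<S>"
  then have "s \<in> T" by blast
  then show "heyting x s \<in> T"
    using assms[OF \<open>T \<in> \<S>\<close>] by (simp add: sublocale_set_def)
qed

text \<open>An intersection is the whole frame only if every member is, and
  \<open>closed_sublocale c\<close> contains \<open>bot\<close> only for
  \<open>c = bot\<close>.\<close>

lemma part_dense_iff:
  "part_dense L i S \<longleftrightarrow>
     sublocale_set S \<and> (\<forall>c \<in> L i. S \<subseteq> closed_sublocale c \<longrightarrow> c = bot)"
proof -
  have "\<Inter>{closed_sublocale a | a. a \<in> L i \<and> S \<subseteq> closed_sublocale a} = UNIV \<longleftrightarrow>
      (\<forall>c \<in> L i. S \<subseteq> closed_sublocale c \<longrightarrow> closed_sublocale c = UNIV)"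
    by auto
  moreover have "closed_sublocale c = UNIV \<longleftrightarrow> c = bot" for c :: 'a
    unfolding closed_sublocale_def by (auto simp: set_eq_iff intro: bot.extremum_uniqueI)
  ultimately show ?thesis by (simp add: part_dense_def)
qed

text \<open>Used contrapositively: if the open sublocale of \<open>a\<close> is
  \<open>i\<close>-dense, then \<open>a\<close> meets every nonzero element of
  \<open>L i\<close>.\<close>

lemma open_sublocale_subset_closed:
  assumes "inf a c = bot"
  shows "open_sublocale a \<subseteq> closed_sublocale c"
proof
  fix z assume "z \<in> open_sublocale a"
  moreover have "inf a c \<le> z" using assms by simp
  ultimately show "z \<in> closed_sublocale c"
    unfolding mem_open_sublocale_iff closed_sublocale_def by blast
qed

lemma inf_bullet: "inf y (bullet L j y) = bot"
proof -
  have "inf y (bullet L j y) \<le> bot"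
    unfolding bullet_def inf_Sup_frame
  proof (rule Sup_least)
    fix b assume "b \<in> {inf y x | x. x \<in> {x \<in> L j. inf x y = bot}}"
    then obtain x where "b = inf y x" "inf x y = bot" by blast
    then show "b \<le> bot" by (simp add: inf.commute[of x])
  qed
  then show ?thesis by (rule bot.extremum_uniqueI)
qed

lemma bullet_antimono:
  assumes "y \<le> z"
  shows "bullet L j z \<le> bullet L j y"
  unfolding bullet_def
proof (rule Sup_subset_mono, safe)
  fix x assume "inf x z = bot"
  then show "inf x y = bot"
    by (metis assms bot.extremum_uniqueI inf_mono order_refl)
qed

text \<open>Meet both sides with \<open>y\<close>: the part of \<open>y\<close> inside its bullet
  vanishes, so distributivity leaves \<open>y = inf y x\<close>.\<close>

lemma le_if_sup_bullet_eq_top: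
  assumes "sup (bullet L j y) x = top"
  shows "y \<le> x"
proof -
  have "y = inf y (sup (bullet L j y) x)" by (simp add: assms)
  also have "\<dots> = inf y x" by (simp add: inf_sup_frame inf_bullet)
  finally show ?thesis by (rule inf.orderI)
qed

text \<open>Finitely many members of an increasing sequence all lie below a single one; if there are
  none, any index serves.\<close>

lemma compact_element_chain:
  fixes f :: "nat \<Rightarrow> 'a::complete_lattice"
  assumes "compact_element a" "mono f" "a \<le> Sup (range f)"
  shows "\<exists>n. a \<le> f n"
proof -
  obtain F where F: "finite F" "F \<subseteq> range f" "a \<le> Sup F"
    using assms unfolding compact_element_def by blast
  obtain A where A: "finite A" "F = f ` A"
    using finite_subset_image[OF F(1,2)] by blast
  then obtain n where "\<forall>k \<in> A. k \<le> n"
    using finite_nat_set_iff_bounded_le by blast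
  then have "Sup F \<le> f n"
    using A assms(2) by (auto intro!: Sup_least dest: monoD)
  with F(3) show ?thesis by (meson order_trans)
qed

lemma Inter_open_sublocale_not_void:
  fixes y :: "nat \<Rightarrow> 'm::frame"
  assumes "compact_element (top :: 'm)"
    and nz: "\<And>n. y n \<noteq> bot"
    and cov: "\<And>n. sup (bullet M j (y (Suc n))) (y n) = top"
  shows "(\<Inter>n. open_sublocale (y n)) \<noteq> void_sublocale"
proof -
  define p where "p = Sup (range (\<lambda>n. bullet M j (y n)))"
  \<comment> \<open>Each cover forces \<open>y (Suc n) \<le> y n\<close>, and bullets reverse the
    order.\<close>
  have "mono (\<lambda>n. bullet M j (y n))"
    unfolding mono_iff_le_Suc using le_if_sup_bullet_eq_top[OF cov] by (auto intro: bullet_antimono)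
  moreover have "bullet M j (y n) \<noteq> top" for n
    \<comment> \<open>A bullet equal to \<open>top\<close> would make \<open>y n\<close> disjoint
      from \<open>top\<close>, hence zero.\<close>
    using inf_bullet[of "y n" M j] nz by auto
  ultimately have "p \<noteq> top"
    using compact_element_chain[OF assms(1)] unfolding p_def by (metis top.extremum_uniqueI order_refl)
  moreover have "p \<in> open_sublocale (y n)" for n
    unfolding mem_open_sublocale_iff
  proof (intro allI impI)
    fix x assume x: "inf (y n) x \<le> p"
    \<comment> \<open>Split \<open>x\<close> along the cover: one piece lies below a bullet and so
      below \<open>p\<close>, the other lies below \<open>p\<close> by \<open>x\<close>.\<close>
    have "x = inf x (sup (bullet M j (y (Suc n))) (y n))" by (simp add: cov)
    also have "\<dots> = sup (inf x (bullet M j (y (Suc n)))) (inf x (y n))"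
      by (rule inf_sup_frame)
    also have "\<dots> \<le> p"
    proof (rule sup_least)
      show "inf x (bullet M j (y (Suc n))) \<le> p"
        unfolding p_def by (rule le_infI2, rule Sup_upper, rule rangeI)
    qed (use x in \<open>simp add: inf_commute\<close>)
    finally show "x \<le> p" .
  qed
  ultimately show ?thesis by (auto simp: void_sublocale_def)
qed

lemma frame_hom_inf:
  assumes "frame_hom h"
  shows "h (inf x y) = inf (h x) (h y)"
  using assms[unfolded frame_hom_def, THEN conjunct2, rule_format, of "{x, y}"] by simp

lemma frame_hom_bot:
  assumes "frame_hom h"
  shows "h bot = bot"
proof -
  have "h (Sup {}) = Sup (h ` {})"
    using assms unfolding frame_hom_def by blast
  then show ?thesis by simp
qed

text \<open>Onto-ness speaks only of the parts. Every element is a join of binary meets of elements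
  of the parts, and \<open>h\<close> preserves both operations.\<close>

lemma onto_map_surj:
  fixes h :: "'m::frame \<Rightarrow> 'l::frame"
  assumes "bilocale L" "frame_hom h" "onto_map M L h"
  shows "surj h"
proof (rule surjI)
  fix x :: 'l
  define A where "A = {inf a1 a2 | a1 a2. a1 \<in> L 1 \<and> a2 \<in> L 2 \<and> inf a1 a2 \<le> x}"
  have parts: "L 1 = h ` M 1" "L 2 = h ` M 2"
    using assms(3) by (auto simp: onto_map_def)
  have "A \<subseteq> range h"
    unfolding A_def parts by (auto simp: frame_hom_inf[OF assms(2), symmetric])
  then have "h ` (h -` A) = A" by (simp only: image_vimage_eq Int_absorb2)
  moreover have "x = Sup A"
    using assms(1)[unfolded bilocale_def] unfolding A_def by simp
  moreover have "h (Sup (h -` A)) = Sup (h ` (h -` A))"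
    using assms(2)[unfolded frame_hom_def] by simp
  ultimately show "h (Sup (h -` A)) = x" by simp
qed

text \<open>The element \<open>w\<close> witnesses that the intersection of the open sublocales is
  not contained in the closed sublocale of \<open>c\<close>.\<close>

lemma dense_sequence_meets:
  fixes L :: "nat \<Rightarrow> 'l::frame set" and M :: "nat \<Rightarrow> 'm::frame set" and a :: "nat \<Rightarrow> 'l"
  assumes ij: "{i, j} = {1, 2}"
    and comp: "prefit_compactification i j M L h"
    and Gd: "Gdelta_dense M i (range (right_adjoint h))"
    and a: "\<And>n. a n \<in> L j" "\<And>n. part_dense L i (open_sublocale (a n))"
    and c: "c \<in> L i" "c \<noteq> bot"
  shows "\<exists>w. (\<forall>n. w \<in> open_sublocale (a n)) \<and> \<not> c \<le> w"
proof -
  have h: "frame_hom h" and L: "bilocale L" and dense: "\<And>x. h x = bot \<Longrightarrow> x = bot"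
    and onto: "onto_map M L h" and pre: "prefit M i j"
    and top_compact: "compact_element (top :: 'm)"
    using comp by (auto simp: prefit_compactification_def compactification_def
        biframe_map_def dense_map_def compact_bilocale_def)
  have "i \<in> {1, 2}" "j \<in> {1, 2}" using ij by blast+
  then have parts: "h ` M i = L i" "h ` M j = L j"
    using onto by (auto simp: onto_map_def)
  obtain c' where c': "c' \<in> M i" "h c' = c"
    using c(1) unfolding parts(1)[symmetric] by blast
  have "\<forall>n. \<exists>b. h b = a n" using a(1) parts(2) by (metis imageE)
  then obtain b where b: "\<And>n. h (b n) = a n" by metis
  have step: "\<exists>y' \<in> M i. y' \<noteq> bot \<and> sup (bullet M j y') (inf (b n) y) = top"
    if "y \<in> M i" "y \<noteq> bot" for y n
  proof -
    \<comment> \<open>Density of \<open>h\<close> carries \<open>y\<close> to a nonzero element of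
      \<open>L i\<close>, which \<open>a n\<close> must meet. Since \<open>h\<close> preserves
      \<open>bot\<close>, the meet of \<open>b n\<close> and \<open>y\<close> is then nonzero, and
      prefitness applies to it.\<close>
    have "h y \<in> L i" "h y \<noteq> bot" using that parts dense by auto
    then have "inf (a n) (h y) \<noteq> bot"
      using a(2)[of n] open_sublocale_subset_closed unfolding part_dense_iff by blast
    then have "inf (b n) y \<noteq> bot"
      by (metis b h frame_hom_inf frame_hom_bot)
    then show ?thesis using pre unfolding prefit_def by blast
  qed
  have "\<exists>y. \<forall>n. (y n \<in> M i \<and> y n \<noteq> bot \<and> y n \<le> b n \<and> y n \<le> c') \<and>
      sup (bullet M j (y (Suc n))) (y n) = top"
  proof (rule dependent_nat_choice)
    have "c' \<noteq> bot" using c(2) c'(2) h frame_hom_bot by metis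
    \<comment> \<open>The sequence starts one step below \<open>c'\<close>; of this first cover only
      the resulting inequality is kept.\<close>
    from step[OF c'(1) this, of 0]
    show "\<exists>y. y \<in> M i \<and> y \<noteq> bot \<and> y \<le> b 0 \<and> y \<le> c'"
      by (meson le_if_sup_bullet_eq_top le_infE)
  next
    fix y n
    assume y: "y \<in> M i \<and> y \<noteq> bot \<and> y \<le> b n \<and> y \<le> c'"
    then obtain y' where y': "y' \<in> M i" "y' \<noteq> bot"
      and cov: "sup (bullet M j y') (inf (b (Suc n)) y) = top"
      using step by blast
    have "y' \<le> inf (b (Suc n)) y" using cov by (rule le_if_sup_bullet_eq_top)
    \<comment> \<open>Enlarging the meet to \<open>y\<close> keeps the cover and gives the relation
      between consecutive terms.\<close>
    moreover have "sup (bullet M j y') y = top"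
      by (metis cov inf.cobounded2 sup_mono order_refl top.extremum_uniqueI)
    ultimately show "\<exists>y'. (y' \<in> M i \<and> y' \<noteq> bot \<and> y' \<le> b (Suc n) \<and> y' \<le> c') \<and>
        sup (bullet M j y') y = top"
      using y y' by (meson le_infE order_trans)
  qed
  then obtain y where y: "\<And>n. y n \<in> M i" "\<And>n. y n \<noteq> bot" "\<And>n. y n \<le> b n" "\<And>n. y n \<le> c'"
    and cov: "\<And>n. sup (bullet M j (y (Suc n))) (y n) = top"
    by blast
  let ?G = "\<Inter>n. open_sublocale (y n)"
  have "?G \<noteq> void_sublocale"
    using top_compact y(2) cov by (rule Inter_open_sublocale_not_void)
  then have "range (right_adjoint h) \<inter> ?G \<noteq> void_sublocale"
    using Gd y(1) unfolding Gdelta_dense_def Gdelta_sublocale_def by blast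
  \<comment> \<open>Since \<open>top\<close> is in the intersection, differing from
    \<open>{top}\<close> must mean having a further element.\<close>
  moreover have "top \<in> range (right_adjoint h) \<inter> ?G"
    using right_adjoint_iff[OF h, of top top]
    by (auto simp: top_mem_open_sublocale top.extremum_unique intro: range_eqI[of _ _ top])
  ultimately obtain w where w: "right_adjoint h w \<in> ?G" "right_adjoint h w \<noteq> top"
    unfolding void_sublocale_def by blast
  have mem: "x \<le> right_adjoint h w" if "inf (y n) x \<le> right_adjoint h w" for n x
    using w(1) that by (auto simp: mem_open_sublocale_iff)
  have "w \<in> open_sublocale (a n)" for n
    unfolding mem_open_sublocale_iff
  proof (intro allI impI)
    fix x assume x: "inf (a n) x \<le> w"
    obtain x' where x': "x = h x'" using onto_map_surj[OF L h onto] by blast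
    \<comment> \<open>The inequality moves to \<open>M\<close> along the adjunction, where
      \<open>y n \<le> b n\<close> lets membership in the open sublocale of \<open>y n\<close>
      apply; the conclusion then moves back to \<open>L\<close>.\<close>
    then have "inf (b n) x' \<le> right_adjoint h w"
      using x by (simp add: right_adjoint_iff[OF h, symmetric] frame_hom_inf[OF h] b)
    then have "inf (y n) x' \<le> right_adjoint h w"
      by (meson y(3) inf_mono order_refl order_trans)
    then show "x \<le> w" using mem x' right_adjoint_iff[OF h] by metis
  qed
  moreover have "\<not> c \<le> w"
  proof
    assume "c \<le> w"
    then have "c' \<le> right_adjoint h w" using c'(2) right_adjoint_iff[OF h] by metis
    \<comment> \<open>Now \<open>y 0 \<le> c' \<le> right_adjoint h w\<close>, so \<open>mem\<close>
      applies to \<open>x = top\<close>.\<close>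
    then have "top \<le> right_adjoint h w"
      using mem[of 0 top] order_trans[OF y(4)[of 0]] by simp
    then show False using w(2) by (simp add: top.extremum_unique)
  qed
  ultimately show ?thesis by blast
qed

theorem corollary2p14:
  fixes L :: "nat \<Rightarrow> 'l::frame set" and i j :: nat
  assumes "{i, j} = {1, 2}"
    and "bilocale L"
    and "\<exists>(M :: nat \<Rightarrow> 'm::frame set) (h :: 'm \<Rightarrow> 'l).
           prefit_compactification i j M L h \<and> Gdelta_dense M i (range (right_adjoint h))"
  shows "Baire_bilocale L i j"
  unfolding Baire_bilocale_def
proof (intro allI impI)
  fix \<U> :: "'l set set"
  assume \<U>: "countable \<U>" "\<forall>U \<in> \<U>. part_dense L i U \<and> part_open L j U"
  obtain M :: "nat \<Rightarrow> 'm set" and h :: "'m \<Rightarrow> 'l"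
    where comp: "prefit_compactification i j M L h"
      and Gd: "Gdelta_dense M i (range (right_adjoint h))"
    using assms(3) by blast
  have "c = bot" if c: "c \<in> L i" "\<Inter>\<U> \<subseteq> closed_sublocale c" for c
  proof (cases "\<U> = {}")
    case True
    \<comment> \<open>The empty intersection is the whole frame.\<close>
    then have "bot \<in> closed_sublocale c" using c(2) by auto
    then show ?thesis by (simp add: closed_sublocale_def bot.extremum_unique)
  next
    case False
    \<comment> \<open>A nonempty countable family is the range of a sequence, with repetitions if it
      is finite.\<close>
    let ?U = "from_nat_into \<U>"
    have U: "range ?U = \<U>" using False \<U>(1) by (rule range_from_nat_into)
    then have mem: "?U n \<in> \<U>" for n by blast
    have "\<forall>n. \<exists>a. a \<in> L j \<and> ?U n = open_sublocale a"
      using \<U>(2) mem unfolding part_open_def by blast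
    then obtain a where a: "\<And>n. a n \<in> L j" "\<And>n. ?U n = open_sublocale (a n)"
      by metis
    have "part_dense L i (open_sublocale (a n))" for n
      using \<U>(2) mem a(2) by metis
    moreover have "w \<in> \<Inter>\<U>" if "\<forall>n. w \<in> open_sublocale (a n)" for w
      using that a(2) U by blast
    ultimately show ?thesis
      using dense_sequence_meets[where a = a, OF assms(1) comp Gd a(1) _ c(1)] c(2)
      unfolding closed_sublocale_def by blast
  qed
  moreover have "sublocale_set (\<Inter>\<U>)"
    using \<U>(2) by (intro sublocale_set_Inter) (simp add: part_dense_def)
  ultimately show "part_dense L i (\<Inter>\<U>)"
    unfolding part_dense_iff by blast
qed

end
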